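(* Let $F_l(z_l)$ and $F_r(z_r)$ be rational functions of the complex variables $z_l$, $z_r$, with values in $\mathbb{C}^{p_l\times m_l}$ and $\mathbb{C}^{p_r\times m_r}$ respectively, without poles at infinity, of McMillan degrees $n_l$ and $n_r$, with realizations $$F_l(z_l)=D_l+C_l(z_lI_{n_l}-A_l)^{-1}B_l,\qquad F_r(z_r)=D_r+C_r(z_rI_{n_r}-A_r)^{-1}B_r .$$ Let $\mathbf{A_l},\mathbf{B_l},\mathbf{C_l},\mathbf{D_l},\mathbf{A_r},\mathbf{B_r},\mathbf{C_r},\mathbf{D_r}$ and $\mathbf{F_l}$, $\mathbf{F_r}$ be the inflated matrices and functions defined in the context. Then $R_{F_l\otimes F_r}=R_{\mathbf{F_l}\mathbf{F_r}}$. That is, the product realization array of $\mathbf{F_l}\mathbf{F_r}$, $$\left(\begin{array}{cc|c}\mathbf{A_l}&\mathbf{B_l}\mathbf{C_r}&\mathbf{B_l}\mathbf{D_r}\\ 0&\mathbf{A_r}&\mathbf{B_r}\\ \hline \mathbf{C_l}&\mathbf{D_l}\mathbf{C_r}&\mathbf{D_l}\mathbf{D_r}\end{array}\right),$$ is a realization of $F_l\otimes F_r$, in the sense that, as rational functions of $(z_l,z_r)$, $$F_l(z_l)\otimes F_r(z_r)=\mathbf{D_l}\mathbf{D_r}+\begin{pmatrix}\mathbf{C_l}&\mathbf{D_l}\mathbf{C_r}\end{pmatrix}\left(\begin{pmatrix}z_lI_{n_lp_r}&0\\ 0&z_rI_{m_ln_r}\end{pmatrix}-\begin{pmatrix}\mathbf{A_l}&\mathbf{B_l}\mathbf{C_r}\\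 0&\mathbf{A_r}\end{pmatrix}\right)^{-1}\begin{pmatrix}\mathbf{B_l}\mathbf{D_r}\\ \mathbf{B_r}\end{pmatrix}.$$
   Context: $\otimes$ is the Kronecker (tensor) product of matrices. Here $A_l\in\mathbb{C}^{n_l\times n_l}$, $B_l\in\mathbb{C}^{n_l\times m_l}$, $C_l\in\mathbb{C}^{p_l\times n_l}$, $D_l\in\mathbb{C}^{p_l\times m_l}$, $A_r\in\mathbb{C}^{n_r\times n_r}$, $B_r\in\mathbb{C}^{n_r\times m_r}$, $C_r\in\mathbb{C}^{p_r\times n_r}$, $D_r\in\mathbb{C}^{p_r\times m_r}$. Inflated matrices: $$\mathbf{A_l}=A_l\otimes I_{p_r},\quad \mathbf{B_l}=B_l\otimes I_{p_r},\quad \mathbf{C_l}=C_l\otimes I_{p_r},\quad \mathbf{D_l}=D_l\otimes I_{p_r},$$ $$\mathbf{A_r}=I_{m_l}\otimes A_r,\quad \mathbf{B_r}=I_{m_l}\otimes B_r,\quad \mathbf{C_r}=I_{m_l}\otimes C_r,\quad \mathbf{D_r}=I_{m_l}\otimes D_r.$$ Inflated functions: $$\mathbf{F_l}(z_l)=\mathbf{C_l}(z_lI_{n_lp_r}-\mathbf{A_l})^{-1}\mathbf{B_l}+\mathbf{D_l},\qquad \mathbf{F_r}(z_r)=\mathbf{C_r}(z_rI_{m_ln_r}-\mathbf{A_r})^{-1}\mathbf{B_r}+\mathbf{D_r}.$$ Product realization array: for functions $G(z_l)=D_1+C_1(z_lI-A_1)^{-1}B_1$ and $H(z_r)=D_2+C_2(z_rI-A_2)^{-1}B_2$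 of compatible sizes (so that $GH$ is defined), $R_{GH}$ denotes the array $$\left(\begin{array}{cc|c}A_1&B_1C_2&B_1D_2\\ 0&A_2&B_2\\ \hline C_1&D_1C_2&D_1D_2\end{array}\right),$$ which realizes $GH$ in the sense that $$G(z_l)H(z_r)=D_1D_2+\begin{pmatrix}C_1&D_1C_2\end{pmatrix}\left(\begin{pmatrix}z_lI&0\\ 0&z_rI\end{pmatrix}-\begin{pmatrix}A_1&B_1C_2\\ 0&A_2\end{pmatrix}\right)^{-1}\begin{pmatrix}B_1D_2\\ B_2\end{pmatrix}.$$ *)

theory Defs
  imports Complex_Main "HOL-Computational_Algebra.Polynomial"
    "Jordan_Normal_Form.Matrix" "Jordan_Normal_Form.Gauss_Jordan_Elimination"
begin

definition kronecker :: "'a::times mat \<Rightarrow> 'a mat \<Rightarrow> 'a mat"  (infixl "\<otimes>\<^sub>K" 75) where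
  "A \<otimes>\<^sub>K B = mat (dim_row A * dim_row B) (dim_col A * dim_col B)
     (\<lambda>(i, j). A $$ (i div dim_row B, j div dim_col B) * B $$ (i mod dim_row B, j mod dim_col B))"

definition append_cols :: "'a::zero mat \<Rightarrow> 'a mat \<Rightarrow> 'a mat"  (infixr "@\<^sub>c" 65) where
  "A @\<^sub>c B = four_block_mat A B (0\<^sub>m 0 (dim_col A)) (0\<^sub>m 0 (dim_col B))"

text \<open>Unspecified for a singular matrix; used only under an invertibility hypothesis.\<close>

definition inv_mat :: "'a::field mat \<Rightarrow> 'a mat" where
  "inv_mat M = the (mat_inverse M)"


text \<open>
  A rational function of one variable is a total function that agrees with a quotient of coprime
  polynomials away from the zeros of the denominator. These zeros are the finite poles; the values
  there are irrelevant. Coprimality forces the correct value at every removable singularity of a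
  non-reduced quotient.
\<close>

definition rational_fun :: "(complex \<Rightarrow> complex) \<Rightarrow> bool" where
  "rational_fun f \<longleftrightarrow> (\<exists>p q. q \<noteq> 0 \<and> coprime p q \<and>
     (\<forall>z. poly q z \<noteq> 0 \<longrightarrow> f z = poly p z / poly q z))"

definition rational_mat_fun :: "nat \<Rightarrow> nat \<Rightarrow> (complex \<Rightarrow> complex mat) \<Rightarrow> bool" where
  "rational_mat_fun p m F \<longleftrightarrow> (\<forall>z. F z \<in> carrier_mat p m) \<and>
     (\<forall>i<p. \<forall>j<m. rational_fun (\<lambda>z. F z $$ (i, j)))"

definition no_pole_at_infinity :: "nat \<Rightarrow> nat \<Rightarrow> (complex \<Rightarrow> complex mat) \<Rightarrow> bool" where
  "no_pole_at_infinity p m F \<longleftrightarrow>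
     (\<forall>i<p. \<forall>j<m. \<exists>c. ((\<lambda>z. F z $$ (i, j)) \<longlongrightarrow> c) at_infinity)"


text \<open>A realization array with blocks \<open>A\<close>, \<open>B\<close>, \<open>C\<close>, \<open>D\<close> is the quadruple \<open>(A, B, C, D)\<close>.\<close>

type_synonym array = "complex mat \<times> complex mat \<times> complex mat \<times> complex mat"

definition array_carrier :: "nat \<Rightarrow> nat \<Rightarrow> nat \<Rightarrow> array set" where
  "array_carrier n p m =
     carrier_mat n n \<times> carrier_mat n m \<times> carrier_mat p n \<times> carrier_mat p m"

text \<open>
  The argument \<open>Z\<close> is the matrix of variables: \<open>z I\<close> for one variable,
  \<open>diag (z\<^sub>l I, z\<^sub>r I)\<close> for two.
\<close>

definition transfer :: "array \<Rightarrow> complex mat \<Rightarrow> complex mat" where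
  "transfer R Z = (case R of (A, B, C, D) \<Rightarrow> D + C * inv_mat (Z - A) * B)"

definition scalar_mat :: "nat \<Rightarrow> complex \<Rightarrow> complex mat" where
  "scalar_mat n z = z \<cdot>\<^sub>m 1\<^sub>m n"

definition realizes :: "nat \<Rightarrow> nat \<Rightarrow> nat \<Rightarrow> array \<Rightarrow> (complex \<Rightarrow> complex mat) \<Rightarrow> bool" where
  "realizes n p m R F \<longleftrightarrow> R \<in> array_carrier n p m \<and>
     (\<forall>z. invertible_mat (scalar_mat n z - fst R) \<longrightarrow> F z = transfer R (scalar_mat n z))"

text \<open>
  For a rational function without pole at infinity, the McMillan degree is the least dimension of
  the state space of a realization.
\<close>

definition mcmillan_degree :: "nat \<Rightarrow> nat \<Rightarrow> (complex \<Rightarrow> complex mat) \<Rightarrow> nat" where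
  "mcmillan_degree p m F = (LEAST n. \<exists>R. realizes n p m R F)"

definition product_array :: "array \<Rightarrow> array \<Rightarrow> array" where
  "product_array R1 R2 = (case (R1, R2) of ((A1, B1, C1, D1), (A2, B2, C2, D2)) \<Rightarrow>
     (four_block_mat A1 (B1 * C2) (0\<^sub>m (dim_row A2) (dim_col A1)) A2,
      B1 * D2 @\<^sub>r B2,
      C1 @\<^sub>c D1 * C2,
      D1 * D2))"

definition inflate_left :: "nat \<Rightarrow> array \<Rightarrow> array" where
  "inflate_left p R = (case R of (A, B, C, D) \<Rightarrow>
     (A \<otimes>\<^sub>K 1\<^sub>m p, B \<otimes>\<^sub>K 1\<^sub>m p, C \<otimes>\<^sub>K 1\<^sub>m p, D \<otimes>\<^sub>K 1\<^sub>m p))"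

definition inflate_right :: "nat \<Rightarrow> array \<Rightarrow> array" where
  "inflate_right m R = (case R of (A, B, C, D) \<Rightarrow>
     (1\<^sub>m m \<otimes>\<^sub>K A, 1\<^sub>m m \<otimes>\<^sub>K B, 1\<^sub>m m \<otimes>\<^sub>K C, 1\<^sub>m m \<otimes>\<^sub>K D))"

definition two_var_mat :: "nat \<Rightarrow> nat \<Rightarrow> complex \<Rightarrow> complex \<Rightarrow> complex mat" where
  "two_var_mat n1 n2 z w =
     four_block_mat (scalar_mat n1 z) (0\<^sub>m n1 n2) (0\<^sub>m n2 n1) (scalar_mat n2 w)"

end

theory Submission
  imports Defs
begin

text \<open>
  By the mixed-product rule (\<open>kronecker_mult_kronecker\<close>),
  \<open>F\<^sub>l \<otimes> F\<^sub>r = (F\<^sub>l \<otimes> I) (I \<otimes> F\<^sub>r)\<close>, so a Kronecker product is an ordinary product of two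
  factors that depend on one variable each. Tensoring with an identity matrix is a unital ring
  homomorphism on square matrices, hence respects inverses, and it is multiplicative and additive
  on rectangular ones; it can therefore be moved through \<open>D + C (z I - A)\<inverse> B\<close>. Consequently
  \<open>F\<^sub>l \<otimes> I\<close> and \<open>I \<otimes> F\<^sub>r\<close> are the transfer functions of the inflated arrays
  (\<open>transfer_inflate_left\<close>, \<open>transfer_inflate_right\<close>).

  It remains to realize an ordinary product (\<open>transfer_product_array\<close>). The state matrix of the
  product array is block upper triangular, so it can be inverted blockwise as soon as each diagonal
  block is invertible. This is why two independent variables are no harder than one: the variable matrices of
  the two factors only enter through their own diagonal block.
\<close>

section \<open>The Kronecker product\<close>

lemma kronecker_carrier [simp, intro]:
  "A \<in> carrier_mat a b \<Longrightarrow> B \<in> carrier_mat c d \<Longrightarrow> A \<otimes>\<^sub>K B \<in> carrier_mat (a * c) (b * d)"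
  by (auto simp: kronecker_def)

lemma div_less_of_less_mult: "(i::nat) < a * c \<Longrightarrow> i div c < a"
  by (simp add: less_mult_imp_div_less)

lemma mod_less_of_less_mult: "(i::nat) < a * c \<Longrightarrow> i mod c < c"
  by (cases "c = 0") auto

lemma kronecker_index:
  assumes "A \<in> carrier_mat a b" "B \<in> carrier_mat c d" "i < a * c" "j < b * d"
  shows "(A \<otimes>\<^sub>K B) $$ (i, j) = A $$ (i div c, j div d) * B $$ (i mod c, j mod d)"
  using assms by (auto simp: kronecker_def)

text \<open>
  The rows and columns of a Kronecker product are numbered by \<open>i * n + j\<close>, so division with remainder
  by \<open>n\<close> is the bijection that turns a sum over its inner index into a double sum.
\<close>

lemma sum_div_times_mod:
  fixes f g :: "nat \<Rightarrow> 'a::comm_semiring_0"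
  shows "(\<Sum>k = 0..<m * n. f (k div n) * g (k mod n)) = (\<Sum>i = 0..<m. f i) * (\<Sum>j = 0..<n. g j)"
proof -
  have "(\<Sum>k = 0..<m * n. f (k div n) * g (k mod n))
      = (\<Sum>(i, j)\<in>{0..<m} \<times> {0..<n}. f i * g j)"
  proof (rule sum.reindex_bij_witness[where i = "\<lambda>(i, j). i * n + j" and j = "\<lambda>k. (k div n, k mod n)"])
    fix x assume "x \<in> {0..<m} \<times> {0..<n}"
    then obtain i j where x: "x = (i, j)" "i < m" "j < n" by auto
    have "i * n + j < Suc i * n" using x by simp
    also have "\<dots> \<le> m * n" using x by (intro mult_le_mono1) simp
    finally show "(case x of (i, j) \<Rightarrow> i * n + j) \<in> {0..<m * n}" using x by simp
  qed (auto simp: div_less_of_less_mult mod_less_of_less_mult)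
  then show ?thesis by (simp add: sum_product sum.cartesian_product)
qed

text \<open>
  The mixed-product rule. Its inner sum runs over pairs of an inner index of \<open>A * C\<close> and one of \<open>B * D\<close>,
  and after exchanging the middle factors it splits into the product of the two inner sums.
\<close>

lemma kronecker_mult_kronecker:
  fixes A B C D :: "'a::comm_semiring_0 mat"
  assumes A: "A \<in> carrier_mat a b" and B: "B \<in> carrier_mat c d"
    and C: "C \<in> carrier_mat b e" and D: "D \<in> carrier_mat d f"
  shows "(A \<otimes>\<^sub>K B) * (C \<otimes>\<^sub>K D) = (A * C) \<otimes>\<^sub>K (B * D)"
proof (rule eq_matI)
  note carr = kronecker_carrier[OF A B] kronecker_carrier[OF C D]
    kronecker_carrier[OF mult_carrier_mat[OF A C] mult_carrier_mat[OF B D]]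
  fix i j
  assume "i < dim_row ((A * C) \<otimes>\<^sub>K (B * D))" "j < dim_col ((A * C) \<otimes>\<^sub>K (B * D))"
  then have ij: "i < a * c" "j < e * f" using carr by auto
  note bounds = ij[THEN div_less_of_less_mult] ij[THEN mod_less_of_less_mult]
  have "((A \<otimes>\<^sub>K B) * (C \<otimes>\<^sub>K D)) $$ (i, j)
      = (\<Sum>k = 0..<b * d. (A \<otimes>\<^sub>K B) $$ (i, k) * (C \<otimes>\<^sub>K D) $$ (k, j))"
    using carr ij by (auto simp: scalar_prod_def)
  also have "\<dots> = (\<Sum>k = 0..<b * d. (A $$ (i div c, k div d) * C $$ (k div d, j div f))
                              * (B $$ (i mod c, k mod d) * D $$ (k mod d, j mod f)))"
    using ij by (intro sum.cong) (auto simp: kronecker_index[OF A B] kronecker_index[OF C D] ac_simps)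
  also have "\<dots> = (\<Sum>k = 0..<b. A $$ (i div c, k) * C $$ (k, j div f))
                 * (\<Sum>k = 0..<d. B $$ (i mod c, k) * D $$ (k, j mod f))"
    by (rule sum_div_times_mod)
  also have "\<dots> = (A * C) $$ (i div c, j div f) * (B * D) $$ (i mod c, j mod f)"
    using A B C D bounds by (auto simp: scalar_prod_def)
  also have "\<dots> = ((A * C) \<otimes>\<^sub>K (B * D)) $$ (i, j)"
    using kronecker_index[OF mult_carrier_mat[OF A C] mult_carrier_mat[OF B D] ij] by simp
  finally show "((A \<otimes>\<^sub>K B) * (C \<otimes>\<^sub>K D)) $$ (i, j) = ((A * C) \<otimes>\<^sub>K (B * D)) $$ (i, j)" .
qed (use assms in \<open>auto simp: kronecker_def\<close>)

lemma kronecker_add_left: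
  fixes A B C :: "'a::semiring_0 mat"
  assumes "A \<in> carrier_mat a b" "B \<in> carrier_mat a b" "C \<in> carrier_mat c d"
  shows "(A + B) \<otimes>\<^sub>K C = A \<otimes>\<^sub>K C + B \<otimes>\<^sub>K C"
  using assms mod_less_of_less_mult[of _ a c] mod_less_of_less_mult[of _ b d]
  by (intro eq_matI) (auto simp: kronecker_def algebra_simps div_less_of_less_mult)

lemma kronecker_add_right:
  fixes A B C :: "'a::semiring_0 mat"
  assumes "A \<in> carrier_mat a b" "B \<in> carrier_mat c d" "C \<in> carrier_mat c d"
  shows "A \<otimes>\<^sub>K (B + C) = A \<otimes>\<^sub>K B + A \<otimes>\<^sub>K C"
  using assms mod_less_of_less_mult[of _ a c] mod_less_of_less_mult[of _ b d]
  by (intro eq_matI) (auto simp: kronecker_def algebra_simps div_less_of_less_mult)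

lemma kronecker_minus_left:
  fixes A B C :: "'a::ring mat"
  assumes "A \<in> carrier_mat a b" "B \<in> carrier_mat a b" "C \<in> carrier_mat c d"
  shows "(A - B) \<otimes>\<^sub>K C = A \<otimes>\<^sub>K C - B \<otimes>\<^sub>K C"
  using assms mod_less_of_less_mult[of _ a c] mod_less_of_less_mult[of _ b d]
  by (intro eq_matI) (auto simp: kronecker_def algebra_simps div_less_of_less_mult)

lemma kronecker_minus_right:
  fixes A B C :: "'a::ring mat"
  assumes "A \<in> carrier_mat a b" "B \<in> carrier_mat c d" "C \<in> carrier_mat c d"
  shows "A \<otimes>\<^sub>K (B - C) = A \<otimes>\<^sub>K B - A \<otimes>\<^sub>K C"
  using assms mod_less_of_less_mult[of _ a c] mod_less_of_less_mult[of _ b d]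
  by (intro eq_matI) (auto simp: kronecker_def algebra_simps div_less_of_less_mult)

lemma scalar_mat_carrier [simp, intro]: "scalar_mat n z \<in> carrier_mat n n"
  by (simp add: scalar_mat_def)

lemma div_mod_eq_iff: "(i::nat) div c = j div c \<and> i mod c = j mod c \<longleftrightarrow> i = j"
  by (metis div_mult_mod_eq)

lemma scalar_mat_kronecker_one: "scalar_mat n z \<otimes>\<^sub>K 1\<^sub>m p = scalar_mat (n * p) z"
  by (intro eq_matI)
    (use div_mod_eq_iff[of _ p] in
      \<open>auto simp: kronecker_def scalar_mat_def div_less_of_less_mult mod_less_of_less_mult\<close>)

lemma one_kronecker_scalar_mat: "1\<^sub>m m \<otimes>\<^sub>K scalar_mat n z = scalar_mat (m * n) z"
  by (intro eq_matI)
    (use div_mod_eq_iff[of _ n] in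
      \<open>auto simp: kronecker_def scalar_mat_def div_less_of_less_mult mod_less_of_less_mult\<close>)

lemma one_kronecker_one: "(1\<^sub>m m :: complex mat) \<otimes>\<^sub>K 1\<^sub>m n = 1\<^sub>m (m * n)"
proof -
  have "scalar_mat k 1 = 1\<^sub>m k" for k by (intro eq_matI) (auto simp: scalar_mat_def)
  then show ?thesis using scalar_mat_kronecker_one[of m 1 n] by simp
qed

section \<open>Inverse matrices\<close>

lemma invertible_matI:
  assumes "M \<in> carrier_mat n n" "N \<in> carrier_mat n n" "M * N = 1\<^sub>m n" "N * M = 1\<^sub>m n"
  shows "invertible_mat M"
  using assms by (auto simp: invertible_mat_def inverts_mat_def intro!: exI[of _ N])

text \<open>
  The witness in \<open>invertible_mat\<close> comes without a dimension; comparing the numbers of columns in the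
  two equations shows that it is square of the right size.
\<close>

lemma invertible_matE:
  assumes "invertible_mat M" and M: "M \<in> carrier_mat n n"
  obtains N where "N \<in> carrier_mat n n" "M * N = 1\<^sub>m n" "N * M = 1\<^sub>m n"
proof -
  obtain N where N: "M * N = 1\<^sub>m (dim_row M)" "N * M = 1\<^sub>m (dim_row N)"
    using assms by (auto simp: invertible_mat_def inverts_mat_def)
  have "dim_row N = n" using arg_cong[OF N(2), of dim_col] M by simp
  moreover have "dim_col N = n" using arg_cong[OF N(1), of dim_col] M by simp
  ultimately show thesis using that[of N] N M by auto
qed

text \<open>
  A two-sided inverse makes \<open>M\<close> a unit of the matrix ring, which rules out failure of the
  elimination behind \<open>inv_mat\<close>; what it then computes is \<open>N\<close> by uniqueness of inverses.
\<close>

lemma inv_mat_eqI: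
  fixes M N :: "'a::field mat"
  assumes M: "M \<in> carrier_mat n n" and N: "N \<in> carrier_mat n n"
    and MN: "M * N = 1\<^sub>m n" and NM: "N * M = 1\<^sub>m n"
  shows "inv_mat M = N"
proof -
  have "M \<in> Units (ring_mat TYPE('a) n ())"
    using assms by (auto simp: Units_def ring_mat_def)
  then obtain K where K: "mat_inverse M = Some K"
    using mat_inverse(1)[OF M, where b = "()"] by (cases "mat_inverse M") auto
  have KM: "K * M = 1\<^sub>m n" "K \<in> carrier_mat n n"
    using mat_inverse(2)[OF M K] by auto
  have "K = K * (M * N)" using KM MN by simp
  also have "\<dots> = (K * M) * N" using KM(2) M N by (rule assoc_mult_mat[symmetric])
  also have "\<dots> = N" using KM N by simp
  finally show ?thesis by (simp add: inv_mat_def K)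
qed

text \<open>
  Back substitution: \<open>P u - X v = f\<close> and \<open>Q v = g\<close> give \<open>v = Q' g\<close> and \<open>u = P' f + P' X Q' g\<close>. The corner is
  written as \<open>- X\<close> because it arises from subtracting the state matrix of a product array.
\<close>

lemma upper_block_triangular_inverse:
  fixes P :: "'a::field mat"
  assumes P: "P \<in> carrier_mat n n" "P' \<in> carrier_mat n n" "P * P' = 1\<^sub>m n" "P' * P = 1\<^sub>m n"
    and Q: "Q \<in> carrier_mat k k" "Q' \<in> carrier_mat k k" "Q * Q' = 1\<^sub>m k" "Q' * Q = 1\<^sub>m k"
    and X: "X \<in> carrier_mat n k"
  shows "four_block_mat P (- X) (0\<^sub>m k n) Q * four_block_mat P' (P' * X * Q') (0\<^sub>m k n) Q' = 1\<^sub>m (n + k)"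
    and "four_block_mat P' (P' * X * Q') (0\<^sub>m k n) Q' * four_block_mat P (- X) (0\<^sub>m k n) Q = 1\<^sub>m (n + k)"
proof -
  have "P * (P' * X * Q') = P * (P' * (X * Q'))"
    using assoc_mult_mat[OF P(2) X Q(2)] by simp
  also have "\<dots> = (P * P') * (X * Q')"
    using P(1,2) Q(1,2) X by (intro assoc_mult_mat[of _ n n _ n _ k, symmetric]) auto
  finally have *: "P * (P' * X * Q') = X * Q'"
    using P(3) Q(2) X by simp
  have "P' * X * Q' * Q = P' * X * (Q' * Q)"
    using P(2) Q(1,2) X by (intro assoc_mult_mat[of _ n k _ k _ k]) auto
  then have **: "P' * X * Q' * Q = P' * X"
    using P(2) Q(4) X by simp
  have XQ': "X * Q' \<in> carrier_mat n k" and P'X: "P' * X \<in> carrier_mat n k"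
    and P'XQ': "P' * X * Q' \<in> carrier_mat n k"
    using P(2) Q(2) X by auto
  have negX: "- X \<in> carrier_mat n k"
    using X by simp
  have right_corner: "P * (P' * X * Q') + - X * Q' = 0\<^sub>m n k"
    using X Q(2) XQ' by (simp add: * add_uminus_minus_mat[OF XQ' XQ'] minus_r_inv_mat[OF XQ'])
  have left_corner: "P' * (- X) + (P' * X * Q') * Q = 0\<^sub>m n k"
    using X P(2) P'X by (simp add: **)
  have "four_block_mat P (- X) (0\<^sub>m k n) Q * four_block_mat P' (P' * X * Q') (0\<^sub>m k n) Q'
      = four_block_mat (P * P' + - X * 0\<^sub>m k n) (P * (P' * X * Q') + - X * Q')
          (0\<^sub>m k n * P' + Q * 0\<^sub>m k n) (0\<^sub>m k n * (P' * X * Q') + Q * Q')"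
    by (rule mult_four_block_mat[OF P(1) negX zero_carrier_mat Q(1) P(2) P'XQ' zero_carrier_mat Q(2)])
  also have "P * P' + - X * 0\<^sub>m k n = 1\<^sub>m n"
    using P(1,2) X by (simp add: P(3))
  also have "P * (P' * X * Q') + - X * Q' = 0\<^sub>m n k"
    by (rule right_corner)
  also have "0\<^sub>m k n * P' + Q * 0\<^sub>m k n = 0\<^sub>m k n"
    using P(1,2) Q(1,2) by simp
  also have "0\<^sub>m k n * (P' * X * Q') + Q * Q' = 1\<^sub>m k"
    using Q(1,2) by (simp add: Q(3) left_mult_zero_mat[OF P'XQ'])
  finally show "four_block_mat P (- X) (0\<^sub>m k n) Q * four_block_mat P' (P' * X * Q') (0\<^sub>m k n) Q' = 1\<^sub>m (n + k)"
    by simp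
  have "four_block_mat P' (P' * X * Q') (0\<^sub>m k n) Q' * four_block_mat P (- X) (0\<^sub>m k n) Q
      = four_block_mat (P' * P + (P' * X * Q') * 0\<^sub>m k n) (P' * (- X) + (P' * X * Q') * Q)
          (0\<^sub>m k n * P + Q' * 0\<^sub>m k n) (0\<^sub>m k n * (- X) + Q' * Q)"
    by (rule mult_four_block_mat[OF P(2) P'XQ' zero_carrier_mat Q(2) P(1) negX zero_carrier_mat Q(1)])
  also have "P' * P + (P' * X * Q') * 0\<^sub>m k n = 1\<^sub>m n"
    using P(1,2) by (simp add: P(4) right_mult_zero_mat[OF P'XQ'])
  also have "P' * (- X) + (P' * X * Q') * Q = 0\<^sub>m n k"
    by (rule left_corner)
  also have "0\<^sub>m k n * P + Q' * 0\<^sub>m k n = 0\<^sub>m k n"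
    using P(1,2) Q(1,2) by simp
  also have "0\<^sub>m k n * (- X) + Q' * Q = 1\<^sub>m k"
    unfolding left_mult_zero_mat[OF negX] by (simp add: Q(4))
  finally show "four_block_mat P' (P' * X * Q') (0\<^sub>m k n) Q' * four_block_mat P (- X) (0\<^sub>m k n) Q = 1\<^sub>m (n + k)"
    by simp
qed

section \<open>The product realization\<close>

lemma append_cols_carrier [simp, intro]:
  "A \<in> carrier_mat n a \<Longrightarrow> B \<in> carrier_mat n b \<Longrightarrow> A @\<^sub>c B \<in> carrier_mat n (a + b)"
  by (auto simp: append_cols_def)

text \<open>
  Stacked matrices are block matrices with empty second blocks, so products with them are instances
  of block multiplication.
\<close>

lemma append_cols_mult_append_rows:
  fixes A :: "'a::comm_semiring_1 mat"
  assumes "A \<in> carrier_mat n a" "B \<in> carrier_mat n b" "C \<in> carrier_mat a m" "D \<in> carrier_mat b m"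
  shows "(A @\<^sub>c B) * (C @\<^sub>r D) = A * C + B * D"
proof -
  have "(A @\<^sub>c B) * (C @\<^sub>r D)
      = four_block_mat (A * C + B * D) (0\<^sub>m n 0) (0\<^sub>m 0 m) (0\<^sub>m 0 0)"
    unfolding append_cols_def append_rows_def using assms
    by (subst mult_four_block_mat[of _ n a _ b _ 0 _ _ m _ 0]) (auto intro!: cong_four_block_mat)
  also have "\<dots> = A * C + B * D" using assms by (intro eq_matI) auto
  finally show ?thesis .
qed

lemma four_block_mat_mult_append_rows:
  fixes A :: "'a::comm_semiring_1 mat"
  assumes "A \<in> carrier_mat n1 a" "B \<in> carrier_mat n1 b" "C \<in> carrier_mat n2 a" "D \<in> carrier_mat n2 b"
    and "X \<in> carrier_mat a m" "Y \<in> carrier_mat b m"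
  shows "four_block_mat A B C D * (X @\<^sub>r Y) = (A * X + B * Y) @\<^sub>r (C * X + D * Y)"
  unfolding append_rows_def using assms
  by (subst mult_four_block_mat[of _ n1 a _ b _ n2 _ _ m _ 0]) (auto intro!: cong_four_block_mat)

lemma product_array_carrier:
  assumes "R1 \<in> array_carrier n1 p k" "R2 \<in> array_carrier n2 k m"
  shows "product_array R1 R2 \<in> array_carrier (n1 + n2) p m"
  using assms by (auto simp: product_array_def array_carrier_def)

text \<open>
  With \<open>U = C1 P B1\<close> and \<open>V = C2 Q B2\<close>, where \<open>P\<close> and \<open>Q\<close> invert \<open>Z1 - A1\<close> and \<open>Z2 - A2\<close>, the four terms of
  \<open>(D1 + U) (D2 + V)\<close> are exactly what the blockwise inverse yields: the corner \<open>P B1 C2 Q\<close> of that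
  inverse produces the mixed term \<open>U V\<close>.
\<close>

lemma transfer_product_array:
  assumes R1: "R1 \<in> array_carrier n1 p k" and R2: "R2 \<in> array_carrier n2 k m"
    and Z1: "Z1 \<in> carrier_mat n1 n1" and Z2: "Z2 \<in> carrier_mat n2 n2"
    and inv1: "invertible_mat (Z1 - fst R1)" and inv2: "invertible_mat (Z2 - fst R2)"
  defines "Z \<equiv> four_block_mat Z1 (0\<^sub>m n1 n2) (0\<^sub>m n2 n1) Z2"
  shows "invertible_mat (Z - fst (product_array R1 R2))"
    and "transfer (product_array R1 R2) Z = transfer R1 Z1 * transfer R2 Z2"
proof -
  obtain A1 B1 C1 D1 A2 B2 C2 D2 where R: "R1 = (A1, B1, C1, D1)" "R2 = (A2, B2, C2, D2)"
    by (metis prod_cases4)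
  have A1: "A1 \<in> carrier_mat n1 n1" and B1: "B1 \<in> carrier_mat n1 k"
    and C1: "C1 \<in> carrier_mat p n1" and D1: "D1 \<in> carrier_mat p k"
    and A2: "A2 \<in> carrier_mat n2 n2" and B2: "B2 \<in> carrier_mat n2 m"
    and C2: "C2 \<in> carrier_mat k n2" and D2: "D2 \<in> carrier_mat k m"
    using R1 R2 by (auto simp: R array_carrier_def)
  define X where "X = B1 * C2"
  have X: "X \<in> carrier_mat n1 n2" using B1 C2 by (simp add: X_def)
  obtain P where P: "P \<in> carrier_mat n1 n1" "(Z1 - A1) * P = 1\<^sub>m n1" "P * (Z1 - A1) = 1\<^sub>m n1"
    using invertible_matE[OF inv1, of n1] Z1 A1 by (auto simp: R minus_carrier_mat)
  obtain Q where Q: "Q \<in> carrier_mat n2 n2" "(Z2 - A2) * Q = 1\<^sub>m n2" "Q * (Z2 - A2) = 1\<^sub>m n2"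
    using invertible_matE[OF inv2, of n2] Z2 A2 by (auto simp: R minus_carrier_mat)
  have M: "Z - fst (product_array R1 R2) = four_block_mat (Z1 - A1) (- X) (0\<^sub>m n2 n1) (Z2 - A2)"
    using A1 A2 B1 C2 Z1 Z2
    by (intro eq_matI) (auto simp: Z_def R product_array_def X_def)
  let ?M = "Z - fst (product_array R1 R2)"
  let ?N = "four_block_mat P (P * X * Q) (0\<^sub>m n2 n1) Q"
  have carr: "?M \<in> carrier_mat (n1 + n2) (n1 + n2)" "?N \<in> carrier_mat (n1 + n2) (n1 + n2)"
    using A1 A2 P Q by (auto simp: M)
  have inverse: "?M * ?N = 1\<^sub>m (n1 + n2)" "?N * ?M = 1\<^sub>m (n1 + n2)"
    unfolding M using upper_block_triangular_inverse[OF _ P _ Q X] A1 A2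
    by (auto simp: minus_carrier_mat)
  show "invertible_mat ?M" by (rule invertible_matI[OF carr inverse])
  have inv_M: "inv_mat ?M = ?N" by (rule inv_mat_eqI[OF carr inverse])
  have inv_1: "inv_mat (Z1 - A1) = P" and inv_2: "inv_mat (Z2 - A2) = Q"
    using P Q A1 A2 by (auto intro!: inv_mat_eqI minus_carrier_mat)
  define U where "U = C1 * P * B1"
  define V where "V = C2 * Q * B2"
  have U: "U \<in> carrier_mat p k" and V: "V \<in> carrier_mat k m"
    using P Q B1 B2 C1 C2 by (auto simp: U_def V_def)
  have "transfer (product_array R1 R2) Z
      = D1 * D2 + (C1 @\<^sub>c D1 * C2) * ?N * (B1 * D2 @\<^sub>r B2)"
    using inv_M by (simp add: transfer_def R product_array_def)
  also have "(C1 @\<^sub>c D1 * C2) * ?N * (B1 * D2 @\<^sub>r B2) = (C1 @\<^sub>c D1 * C2) * (?N * (B1 * D2 @\<^sub>r B2))"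
    using B1 B2 C1 C2 D1 D2 carr by (intro assoc_mult_mat[of _ p "n1 + n2" _ "n1 + n2" _ m]) auto
  also have "?N * (B1 * D2 @\<^sub>r B2) = (P * (B1 * D2) + P * X * Q * B2) @\<^sub>r Q * B2"
    using P Q X B1 B2 D2 by (subst four_block_mat_mult_append_rows[of _ n1 n1 _ n2 _ n2 _ _ m]) auto
  also have "(C1 @\<^sub>c D1 * C2) * \<dots> = C1 * (P * (B1 * D2) + P * X * Q * B2) + D1 * C2 * (Q * B2)"
    using P Q X B1 B2 C1 C2 D1 D2 by (intro append_cols_mult_append_rows[of _ p n1 _ n2 _ m]) auto
  also have "C1 * (P * (B1 * D2) + P * X * Q * B2) = U * D2 + U * V"
  proof -
    have "C1 * (P * (B1 * D2) + P * X * Q * B2) = C1 * (P * (B1 * D2)) + C1 * (P * X * Q * B2)"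
      using P Q X B1 B2 C1 D2 by (intro mult_add_distrib_mat[of _ p n1 _ m]) auto
    also have "C1 * (P * (B1 * D2)) = C1 * P * (B1 * D2)"
      using P(1) B1 C1 D2 by (intro assoc_mult_mat[of _ p n1 _ n1 _ m, symmetric]) auto
    also have "\<dots> = U * D2"
      unfolding U_def using P(1) B1 C1 D2 by (intro assoc_mult_mat[of _ p n1 _ k _ m, symmetric]) auto
    also have "C1 * (P * X * Q * B2) = U * V"
    proof -
      have "P * X = P * B1 * C2"
        unfolding X_def using P(1) B1 C2 by (intro assoc_mult_mat[of _ n1 n1 _ k _ n2, symmetric]) auto
      moreover have "P * X * Q * B2 = P * X * (Q * B2)"
        using P(1) Q(1) X B2 by (intro assoc_mult_mat[of _ n1 n2 _ n2 _ m]) auto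
      moreover have "P * B1 * C2 * (Q * B2) = P * B1 * (C2 * (Q * B2))"
        using P(1) Q(1) B1 B2 C2 by (intro assoc_mult_mat[of _ n1 k _ n2 _ m]) auto
      moreover have "C2 * (Q * B2) = V"
        unfolding V_def using Q(1) B2 C2 by (intro assoc_mult_mat[of _ k n2 _ n2 _ m, symmetric]) auto
      moreover have "C1 * (P * B1 * V) = C1 * (P * B1) * V"
        using P(1) B1 C1 V by (intro assoc_mult_mat[of _ p n1 _ k _ m, symmetric]) auto
      moreover have "C1 * (P * B1) = U"
        unfolding U_def using P(1) B1 C1 by (intro assoc_mult_mat[of _ p n1 _ n1 _ k, symmetric]) auto
      ultimately show ?thesis by simp
    qed
    finally show ?thesis .
  qed
  also have "D1 * C2 * (Q * B2) = D1 * (C2 * (Q * B2))"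
    using Q(1) B2 C2 D1 by (intro assoc_mult_mat[of _ p k _ n2 _ m]) auto
  also have "C2 * (Q * B2) = V"
    unfolding V_def using Q(1) B2 C2 by (intro assoc_mult_mat[of _ k n2 _ n2 _ m, symmetric]) auto
  also have "D1 * D2 + (U * D2 + U * V + D1 * V) = (D1 + U) * (D2 + V)"
  proof -
    have product: "(D1 + U) * (D2 + V) = (D1 * D2 + D1 * V) + (U * D2 + U * V)"
      by (simp add: add_mult_distrib_mat[OF D1 U add_carrier_mat[OF V]]
          mult_add_distrib_mat[OF D1 D2 V] mult_add_distrib_mat[OF U D2 V])
    have "W + (X + Y + Z) = (W + Z) + (X + Y)"
      if "W \<in> carrier_mat p m" "X \<in> carrier_mat p m" "Y \<in> carrier_mat p m" "Z \<in> carrier_mat p m"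
      for W X Y Z :: "complex mat"
      using that by (intro eq_matI) auto
    from this[OF mult_carrier_mat[OF D1 D2] mult_carrier_mat[OF U D2] mult_carrier_mat[OF U V]
        mult_carrier_mat[OF D1 V]]
    have "D1 * D2 + (U * D2 + U * V + D1 * V) = (D1 * D2 + D1 * V) + (U * D2 + U * V)" .
    with product show ?thesis by simp
  qed
  also have "\<dots> = transfer R1 Z1 * transfer R2 Z2"
    by (simp add: transfer_def R inv_1 inv_2 U_def V_def)
  finally show "transfer (product_array R1 R2) Z = transfer R1 Z1 * transfer R2 Z2" .
qed

section \<open>Inflated realizations and the Kronecker product of transfer functions\<close>

lemma inflate_left_carrier:
  "R \<in> array_carrier n p m \<Longrightarrow> inflate_left q R \<in> array_carrier (n * q) (p * q) (m * q)"
  by (auto simp: inflate_left_def array_carrier_def)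

lemma inflate_right_carrier:
  "R \<in> array_carrier n p m \<Longrightarrow> inflate_right q R \<in> array_carrier (q * n) (q * p) (q * m)"
  by (auto simp: inflate_right_def array_carrier_def)

text \<open>
  If \<open>N\<close> inverts \<open>z I - A\<close>, then \<open>N \<otimes> I\<close> inverts \<open>(z I - A) \<otimes> I\<close>, which is the resolvent denominator of the
  inflated array because \<open>z I \<otimes> I = z I\<close>. The factor \<open>I\<close> can then be collected from all four blocks.
\<close>

lemma transfer_inflate_left:
  assumes R: "R \<in> array_carrier n p m" and inv: "invertible_mat (scalar_mat n z - fst R)"
  shows "invertible_mat (scalar_mat (n * q) z - fst (inflate_left q R))"
    and "transfer (inflate_left q R) (scalar_mat (n * q) z) = transfer R (scalar_mat n z) \<otimes>\<^sub>K 1\<^sub>m q"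
proof -
  obtain A B C D where ABCD: "R = (A, B, C, D)" by (metis prod_cases4)
  have A: "A \<in> carrier_mat n n" and B: "B \<in> carrier_mat n m"
    and C: "C \<in> carrier_mat p n" and D: "D \<in> carrier_mat p m"
    using R by (auto simp: ABCD array_carrier_def)
  have I: "(1\<^sub>m q :: complex mat) \<in> carrier_mat q q" by simp
  let ?M = "scalar_mat n z - A"
  have M: "?M \<in> carrier_mat n n" using A by (rule minus_carrier_mat)
  obtain N where N: "N \<in> carrier_mat n n" "?M * N = 1\<^sub>m n" "N * ?M = 1\<^sub>m n"
    using invertible_matE[OF inv[unfolded ABCD fst_conv] M] by blast
  have inflated: "scalar_mat (n * q) z - fst (inflate_left q R) = ?M \<otimes>\<^sub>K 1\<^sub>m q"
    by (simp add: ABCD inflate_left_def kronecker_minus_left[OF scalar_mat_carrier A I]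
        scalar_mat_kronecker_one)
  have carr: "?M \<otimes>\<^sub>K 1\<^sub>m q \<in> carrier_mat (n * q) (n * q)" "N \<otimes>\<^sub>K 1\<^sub>m q \<in> carrier_mat (n * q) (n * q)"
    using M N by auto
  have inverse: "(?M \<otimes>\<^sub>K 1\<^sub>m q) * (N \<otimes>\<^sub>K 1\<^sub>m q) = 1\<^sub>m (n * q)"
    "(N \<otimes>\<^sub>K 1\<^sub>m q) * (?M \<otimes>\<^sub>K 1\<^sub>m q) = 1\<^sub>m (n * q)"
    by (simp_all add: kronecker_mult_kronecker[OF M I N(1) I] kronecker_mult_kronecker[OF N(1) I M I]
        N one_kronecker_one)
  show "invertible_mat (scalar_mat (n * q) z - fst (inflate_left q R))"
    unfolding inflated by (rule invertible_matI[OF carr inverse])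
  have "transfer (inflate_left q R) (scalar_mat (n * q) z)
      = D \<otimes>\<^sub>K 1\<^sub>m q + (C \<otimes>\<^sub>K 1\<^sub>m q) * (N \<otimes>\<^sub>K 1\<^sub>m q) * (B \<otimes>\<^sub>K 1\<^sub>m q)"
    using inflated inv_mat_eqI[OF carr inverse] by (simp add: transfer_def ABCD inflate_left_def)
  also have "\<dots> = (D + C * N * B) \<otimes>\<^sub>K 1\<^sub>m q"
    using B C D N I by (simp add: kronecker_mult_kronecker[OF C I N(1) I]
        kronecker_mult_kronecker[OF mult_carrier_mat[OF C N(1)] I B I]
        kronecker_add_left[OF D mult_carrier_mat[OF mult_carrier_mat[OF C N(1)] B] I]
        del: assoc_mult_mat)
  also have "D + C * N * B = transfer R (scalar_mat n z)"
    by (simp add: transfer_def ABCD inv_mat_eqI[OF M N])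
  finally show "transfer (inflate_left q R) (scalar_mat (n * q) z)
      = transfer R (scalar_mat n z) \<otimes>\<^sub>K 1\<^sub>m q" .
qed

text \<open>The mirror image: \<open>I \<otimes> N\<close> inverts \<open>I \<otimes> (z I - A)\<close>.\<close>

lemma transfer_inflate_right:
  assumes R: "R \<in> array_carrier n p m" and inv: "invertible_mat (scalar_mat n z - fst R)"
  shows "invertible_mat (scalar_mat (q * n) z - fst (inflate_right q R))"
    and "transfer (inflate_right q R) (scalar_mat (q * n) z) = 1\<^sub>m q \<otimes>\<^sub>K transfer R (scalar_mat n z)"
proof -
  obtain A B C D where ABCD: "R = (A, B, C, D)" by (metis prod_cases4)
  have A: "A \<in> carrier_mat n n" and B: "B \<in> carrier_mat n m"
    and C: "C \<in> carrier_mat p n" and D: "D \<in> carrier_mat p m"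
    using R by (auto simp: ABCD array_carrier_def)
  have I: "(1\<^sub>m q :: complex mat) \<in> carrier_mat q q" by simp
  let ?M = "scalar_mat n z - A"
  have M: "?M \<in> carrier_mat n n" using A by (rule minus_carrier_mat)
  obtain N where N: "N \<in> carrier_mat n n" "?M * N = 1\<^sub>m n" "N * ?M = 1\<^sub>m n"
    using invertible_matE[OF inv[unfolded ABCD fst_conv] M] by blast
  have inflated: "scalar_mat (q * n) z - fst (inflate_right q R) = 1\<^sub>m q \<otimes>\<^sub>K ?M"
    by (simp add: ABCD inflate_right_def kronecker_minus_right[OF I scalar_mat_carrier A]
        one_kronecker_scalar_mat)
  have carr: "1\<^sub>m q \<otimes>\<^sub>K ?M \<in> carrier_mat (q * n) (q * n)" "1\<^sub>m q \<otimes>\<^sub>K N \<in> carrier_mat (q * n) (q * n)"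
    using M N by auto
  have inverse: "(1\<^sub>m q \<otimes>\<^sub>K ?M) * (1\<^sub>m q \<otimes>\<^sub>K N) = 1\<^sub>m (q * n)"
    "(1\<^sub>m q \<otimes>\<^sub>K N) * (1\<^sub>m q \<otimes>\<^sub>K ?M) = 1\<^sub>m (q * n)"
    by (simp_all add: kronecker_mult_kronecker[OF I M I N(1)] kronecker_mult_kronecker[OF I N(1) I M]
        N one_kronecker_one)
  show "invertible_mat (scalar_mat (q * n) z - fst (inflate_right q R))"
    unfolding inflated by (rule invertible_matI[OF carr inverse])
  have "transfer (inflate_right q R) (scalar_mat (q * n) z)
      = 1\<^sub>m q \<otimes>\<^sub>K D + (1\<^sub>m q \<otimes>\<^sub>K C) * (1\<^sub>m q \<otimes>\<^sub>K N) * (1\<^sub>m q \<otimes>\<^sub>K B)"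
    using inflated inv_mat_eqI[OF carr inverse] by (simp add: transfer_def ABCD inflate_right_def)
  also have "\<dots> = 1\<^sub>m q \<otimes>\<^sub>K (D + C * N * B)"
    using B C D N I by (simp add: kronecker_mult_kronecker[OF I C I N(1)]
        kronecker_mult_kronecker[OF I mult_carrier_mat[OF C N(1)] I B]
        kronecker_add_right[OF I D mult_carrier_mat[OF mult_carrier_mat[OF C N(1)] B]]
        del: assoc_mult_mat)
  also have "D + C * N * B = transfer R (scalar_mat n z)"
    by (simp add: transfer_def ABCD inv_mat_eqI[OF M N])
  finally show "transfer (inflate_right q R) (scalar_mat (q * n) z)
      = 1\<^sub>m q \<otimes>\<^sub>K transfer R (scalar_mat n z)" .
qed

theorem proposition2p1:
  fixes F\<^sub>l F\<^sub>r :: "complex \<Rightarrow> complex mat"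
    and A\<^sub>l B\<^sub>l C\<^sub>l D\<^sub>l A\<^sub>r B\<^sub>r C\<^sub>r D\<^sub>r :: "complex mat"
    and n\<^sub>l p\<^sub>l m\<^sub>l n\<^sub>r p\<^sub>r m\<^sub>r :: nat
  assumes "rational_mat_fun p\<^sub>l m\<^sub>l F\<^sub>l" and "rational_mat_fun p\<^sub>r m\<^sub>r F\<^sub>r"
    and "no_pole_at_infinity p\<^sub>l m\<^sub>l F\<^sub>l" and "no_pole_at_infinity p\<^sub>r m\<^sub>r F\<^sub>r"
    and "mcmillan_degree p\<^sub>l m\<^sub>l F\<^sub>l = n\<^sub>l" and "mcmillan_degree p\<^sub>r m\<^sub>r F\<^sub>r = n\<^sub>r"
    and "realizes n\<^sub>l p\<^sub>l m\<^sub>l (A\<^sub>l, B\<^sub>l, C\<^sub>l, D\<^sub>l) F\<^sub>l"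
    and "realizes n\<^sub>r p\<^sub>r m\<^sub>r (A\<^sub>r, B\<^sub>r, C\<^sub>r, D\<^sub>r) F\<^sub>r"
  shows "let R\<^sub>l = inflate_left p\<^sub>r (A\<^sub>l, B\<^sub>l, C\<^sub>l, D\<^sub>l);
             R\<^sub>r = inflate_right m\<^sub>l (A\<^sub>r, B\<^sub>r, C\<^sub>r, D\<^sub>r);
             R = product_array R\<^sub>l R\<^sub>r;
             Z = two_var_mat (n\<^sub>l * p\<^sub>r) (m\<^sub>l * n\<^sub>r)
         in R \<in> array_carrier (n\<^sub>l * p\<^sub>r + m\<^sub>l * n\<^sub>r) (p\<^sub>l * p\<^sub>r) (m\<^sub>l * m\<^sub>r) \<and>
            (\<forall>z\<^sub>l z\<^sub>r. invertible_mat (scalar_mat n\<^sub>l z\<^sub>l - A\<^sub>l) \<longrightarrow>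
                     invertible_mat (scalar_mat n\<^sub>r z\<^sub>r - A\<^sub>r) \<longrightarrow>
               invertible_mat (Z z\<^sub>l z\<^sub>r - fst R) \<and>
               transfer R\<^sub>l (scalar_mat (n\<^sub>l * p\<^sub>r) z\<^sub>l) * transfer R\<^sub>r (scalar_mat (m\<^sub>l * n\<^sub>r) z\<^sub>r)
                 = transfer R (Z z\<^sub>l z\<^sub>r) \<and>
               F\<^sub>l z\<^sub>l \<otimes>\<^sub>K F\<^sub>r z\<^sub>r = transfer R (Z z\<^sub>l z\<^sub>r))"
proof -
  define R\<^sub>l where "R\<^sub>l = (A\<^sub>l, B\<^sub>l, C\<^sub>l, D\<^sub>l)"
  define R\<^sub>r where "R\<^sub>r = (A\<^sub>r, B\<^sub>r, C\<^sub>r, D\<^sub>r)"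
  have R: "R\<^sub>l \<in> array_carrier n\<^sub>l p\<^sub>l m\<^sub>l" "R\<^sub>r \<in> array_carrier n\<^sub>r p\<^sub>r m\<^sub>r"
    using assms(7,8) by (simp_all add: realizes_def R\<^sub>l_def R\<^sub>r_def)
  note infl = inflate_left_carrier[OF R(1), of p\<^sub>r] inflate_right_carrier[OF R(2), of m\<^sub>l]
  show ?thesis
    unfolding Let_def R\<^sub>l_def[symmetric] R\<^sub>r_def[symmetric]
  proof (intro conjI allI impI)
    show "product_array (inflate_left p\<^sub>r R\<^sub>l) (inflate_right m\<^sub>l R\<^sub>r)
        \<in> array_carrier (n\<^sub>l * p\<^sub>r + m\<^sub>l * n\<^sub>r) (p\<^sub>l * p\<^sub>r) (m\<^sub>l * m\<^sub>r)"
      by (rule product_array_carrier[OF infl])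
  next
    fix z\<^sub>l z\<^sub>r
    assume inv: "invertible_mat (scalar_mat n\<^sub>l z\<^sub>l - A\<^sub>l)" "invertible_mat (scalar_mat n\<^sub>r z\<^sub>r - A\<^sub>r)"
    then have invl: "invertible_mat (scalar_mat n\<^sub>l z\<^sub>l - fst R\<^sub>l)"
      and invr: "invertible_mat (scalar_mat n\<^sub>r z\<^sub>r - fst R\<^sub>r)"
      by (simp_all add: R\<^sub>l_def R\<^sub>r_def)
    note prod = transfer_product_array[OF infl scalar_mat_carrier scalar_mat_carrier
        transfer_inflate_left(1)[OF R(1) invl] transfer_inflate_right(1)[OF R(2) invr],
        folded two_var_mat_def]
    show "invertible_mat (two_var_mat (n\<^sub>l * p\<^sub>r) (m\<^sub>l * n\<^sub>r) z\<^sub>l z\<^sub>r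
        - fst (product_array (inflate_left p\<^sub>r R\<^sub>l) (inflate_right m\<^sub>l R\<^sub>r)))"
      by (rule prod(1))
    show "transfer (inflate_left p\<^sub>r R\<^sub>l) (scalar_mat (n\<^sub>l * p\<^sub>r) z\<^sub>l)
        * transfer (inflate_right m\<^sub>l R\<^sub>r) (scalar_mat (m\<^sub>l * n\<^sub>r) z\<^sub>r)
        = transfer (product_array (inflate_left p\<^sub>r R\<^sub>l) (inflate_right m\<^sub>l R\<^sub>r))
            (two_var_mat (n\<^sub>l * p\<^sub>r) (m\<^sub>l * n\<^sub>r) z\<^sub>l z\<^sub>r)"
      by (rule prod(2)[symmetric])
    have F: "F\<^sub>l z\<^sub>l = transfer R\<^sub>l (scalar_mat n\<^sub>l z\<^sub>l)" "F\<^sub>r z\<^sub>r = transfer R\<^sub>r (scalar_mat n\<^sub>r z\<^sub>r)"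
      using assms(7,8) inv by (simp_all add: realizes_def R\<^sub>l_def R\<^sub>r_def)
    have carr: "F\<^sub>l z\<^sub>l \<in> carrier_mat p\<^sub>l m\<^sub>l" "F\<^sub>r z\<^sub>r \<in> carrier_mat p\<^sub>r m\<^sub>r"
      using assms(1,2) by (simp_all add: rational_mat_fun_def)
    have "F\<^sub>l z\<^sub>l \<otimes>\<^sub>K F\<^sub>r z\<^sub>r = (F\<^sub>l z\<^sub>l \<otimes>\<^sub>K 1\<^sub>m p\<^sub>r) * (1\<^sub>m m\<^sub>l \<otimes>\<^sub>K F\<^sub>r z\<^sub>r)"
      using carr by (simp add: kronecker_mult_kronecker[OF carr(1) one_carrier_mat one_carrier_mat carr(2)])
    also have "\<dots> = transfer (product_array (inflate_left p\<^sub>r R\<^sub>l) (inflate_right m\<^sub>l R\<^sub>r))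
            (two_var_mat (n\<^sub>l * p\<^sub>r) (m\<^sub>l * n\<^sub>r) z\<^sub>l z\<^sub>r)"
      by (simp add: prod(2) F transfer_inflate_left(2)[OF R(1) invl]
          transfer_inflate_right(2)[OF R(2) invr])
    finally show "F\<^sub>l z\<^sub>l \<otimes>\<^sub>K F\<^sub>r z\<^sub>r
        = transfer (product_array (inflate_left p\<^sub>r R\<^sub>l) (inflate_right m\<^sub>l R\<^sub>r))
            (two_var_mat (n\<^sub>l * p\<^sub>r) (m\<^sub>l * n\<^sub>r) z\<^sub>l z\<^sub>r)" .
  qed
qed

end
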